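(* Let $f\in\mathrm{Homeo}_+(\mathcal S)$ be induced by a homeomorphism $f_1\in\mathrm{Homeo}_+(\mathbb S^1)$. (1) If $\rho(f)=p/q$ (with $p,q\in\mathbb Z_+$), then every point $s\in\mathcal S$ is a $p/q$-fiber periodic point or the orbit of $s$ is asymptotic to the orbit of a $p/q$-fiber periodic point. (2) If $\rho(f)\notin\mathbb Q$, then $f$ is semi-conjugate to the rotation by $\rho(f)$, that is, there is a continuous surjective map $h:\mathcal S\to\mathcal S$ with $h\circ f=R\circ h$, where $R(s)=s+\sigma(\rho(f))$.
   Context: Universal one-dimensional solenoid: $\mathcal S=\varprojlim_n \mathbb R/n\mathbb Z$ (index set $\mathbb Z_+$ ordered by divisibility, bonding maps the canonical projections), a compact connected abelian topological group, with projections $\pi_n:\mathcal S\to\mathbb R/n\mathbb Z$; $\mathbb S^1=\mathbb R/\mathbb Z$. Let $\sigma:\mathbb R\to\mathcal S$, $\sigma(t)=(t \bmod n)_n$, be the dense one-parameter subgroup. $\mathrm{Homeo}_+(\mathcal S)$ is the group of orientation-preserving (along leaves) homeomorphisms of $\mathcal S$ isotopic to the identity; $\mathrm{Homeo}_+(\mathbb S^1)$ is the group of orientation-preserving homeomorphisms of $\mathbb S^1$. Induced homeomorphisms (of degree 1): given $f_1\in\mathrm{Homeo}_+(\mathbb S^1)$ and a lift $F_1:\mathbb R\to\mathbb R$ of $f_1$ (so $F_1(x+1)=F_1(x)+1$), for each $n\ge 1$ let $f_n:\mathbb R/n\mathbb Z\to\mathbb R/n\mathbb Z$ be the homeomorphism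 obtained by projecting $F_1$. These are compatible with the bonding maps and define a homeomorphism $f=\varprojlim f_n:\mathcal S\to\mathcal S$, said to be induced by $f_1$ (via $F_1$). Rotation number: $\rho(f)=\lim_{n\to\infty}(F_1^n(x)-x)/n\in\mathbb R$, which does not depend on $x\in\mathbb R$. A point $s\in\mathcal S$ is $p/q$-fiber periodic for $f$, with $p,q\in\mathbb Z_+$, if $f^q(s)=s+\sigma(p)$. The orbit of $s$ is asymptotic to the orbit of $s'$ if $d(f^n(s),f^n(s'))\to0$ as $n\to\infty$, where $d$ is a metric compatible with the topology of $\mathcal S$. *)

theory Defs
  imports "HOL-Analysis.Analysis" "HOL-Algebra.Product_Groups"
begin

section \<open>The circles \<open>\<real>/n\<int>\<close>\<close>

definition real_group :: "real monoid"
  where "real_group = \<lparr>carrier = UNIV, monoid.mult = (+), one = 0\<rparr>"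

definition multiples :: "nat \<Rightarrow> real set"
  where "multiples n = range (\<lambda>k::int. real n * of_int k)"

definition circle_group :: "nat \<Rightarrow> real set monoid"
  where "circle_group n = real_group Mod multiples n"

definition cls :: "nat \<Rightarrow> real \<Rightarrow> real set"
  where "cls n x = multiples n #>\<^bsub>real_group\<^esub> x"

text \<open>The quotient topology on \<open>\<real>/n\<int>\<close>; see \<open>quotient_map_cls\<close> below.\<close>

definition circle_top :: "nat \<Rightarrow> real set topology"
  where "circle_top n = topology (\<lambda>U. U \<subseteq> carrier (circle_group n) \<and> open {x. cls n x \<in> U})"

text \<open>The canonical projection \<open>\<real>/n\<int> \<rightarrow> \<real>/m\<int>\<close> for \<open>m dvd n\<close>: the union below is a
  single coset in that case, see \<open>bond_cls\<close>.\<close>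

definition bond :: "nat \<Rightarrow> real set \<Rightarrow> real set"
  where "bond m A = (\<Union>x\<in>A. cls m x)"


section \<open>The solenoid\<close>

text \<open>Points are extensional families indexed by the positive integers, as required by
  \<^const>\<open>product_topology\<close> and \<^const>\<open>product_group\<close>; thus \<open>s n\<close> is the projection to \<open>\<real>/n\<int>\<close>.\<close>

definition solenoid :: "(nat \<Rightarrow> real set) set"
  where "solenoid = {s \<in> carrier (product_group {0<..} circle_group).
           \<forall>m n. 0 < m \<longrightarrow> 0 < n \<longrightarrow> m dvd n \<longrightarrow> s m = bond m (s n)}"

definition solenoid_group :: "(nat \<Rightarrow> real set) monoid"
  where "solenoid_group = (product_group {0<..} circle_group)\<lparr>carrier := solenoid\<rparr>"

definition solenoid_top :: "(nat \<Rightarrow> real set) topology"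
  where "solenoid_top = subtopology (product_topology circle_top {0<..}) solenoid"

definition solenoid_sigma :: "real \<Rightarrow> nat \<Rightarrow> real set"
  where "solenoid_sigma t = (\<lambda>n\<in>{0<..}. cls n t)"

definition translate :: "(nat \<Rightarrow> real set) \<Rightarrow> real \<Rightarrow> nat \<Rightarrow> real set"
  where "translate s t = s \<otimes>\<^bsub>solenoid_group\<^esub> solenoid_sigma t"


section \<open>Homeomorphisms\<close>

definition is_lift :: "(real \<Rightarrow> real) \<Rightarrow> (real set \<Rightarrow> real set) \<Rightarrow> bool"
  where "is_lift F f1 \<longleftrightarrow> continuous_on UNIV F \<and> (\<forall>x. f1 (cls 1 x) = cls 1 (F x))"

definition homeo_plus_circle :: "(real set \<Rightarrow> real set) \<Rightarrow> bool"
  where "homeo_plus_circle f1 \<longleftrightarrow>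
    homeomorphic_map (circle_top 1) (circle_top 1) f1 \<and> (\<exists>F. is_lift F f1 \<and> strict_mono F)"

text \<open>The leaf through \<open>s\<close> is parametrised by \<open>t \<mapsto> s + \<sigma>(t)\<close>; preserving the orientation
  along leaves means being strictly increasing in these parametrisations.\<close>

definition leaf_orientation_preserving :: "((nat \<Rightarrow> real set) \<Rightarrow> (nat \<Rightarrow> real set)) \<Rightarrow> bool"
  where "leaf_orientation_preserving f \<longleftrightarrow>
    (\<forall>s\<in>solenoid. \<exists>\<phi>. strict_mono \<phi> \<and> (\<forall>t. f (translate s t) = translate (f s) (\<phi> t)))"

definition homeo_plus_solenoid :: "((nat \<Rightarrow> real set) \<Rightarrow> (nat \<Rightarrow> real set)) \<Rightarrow> bool"
  where "homeo_plus_solenoid f \<longleftrightarrow>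
    homeomorphic_map solenoid_top solenoid_top f \<and>
    homotopic_with (homeomorphic_map solenoid_top solenoid_top) solenoid_top solenoid_top id f \<and>
    leaf_orientation_preserving f"

text \<open>The maps \<open>fn n\<close> on \<open>\<real>/n\<int>\<close> are the projections of \<open>F\<close>, and \<open>f\<close> is their inverse limit.\<close>

definition induced_via :: "(real \<Rightarrow> real) \<Rightarrow> ((nat \<Rightarrow> real set) \<Rightarrow> (nat \<Rightarrow> real set)) \<Rightarrow> bool"
  where "induced_via F f \<longleftrightarrow>
    (\<exists>fn. (\<forall>n>0. \<forall>x. fn n (cls n x) = cls n (F x)) \<and>
          (\<forall>s\<in>solenoid. f s = (\<lambda>n\<in>{0<..}. fn n (s n))))"


section \<open>Dynamics\<close>

definition rotation_number :: "(real \<Rightarrow> real) \<Rightarrow> real"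
  where "rotation_number F = (THE \<rho>. \<forall>x. (\<lambda>n. ((F ^^ n) x - x) / real n) \<longlonglongrightarrow> \<rho>)"

definition fiber_periodic ::
    "nat \<Rightarrow> nat \<Rightarrow> ((nat \<Rightarrow> real set) \<Rightarrow> (nat \<Rightarrow> real set)) \<Rightarrow> (nat \<Rightarrow> real set) \<Rightarrow> bool"
  where "fiber_periodic p q f s \<longleftrightarrow>
    0 < p \<and> 0 < q \<and> s \<in> solenoid \<and> (f ^^ q) s = translate s (real p)"

definition asymptotic_orbits ::
    "((nat \<Rightarrow> real set) \<Rightarrow> (nat \<Rightarrow> real set) \<Rightarrow> real) \<Rightarrow> ((nat \<Rightarrow> real set) \<Rightarrow> (nat \<Rightarrow> real set)) \<Rightarrow>
     (nat \<Rightarrow> real set) \<Rightarrow> (nat \<Rightarrow> real set) \<Rightarrow> bool"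
  where "asymptotic_orbits d f s s' \<longleftrightarrow> (\<lambda>n. d ((f ^^ n) s) ((f ^^ n) s')) \<longlonglongrightarrow> 0"

definition compatible_metric :: "((nat \<Rightarrow> real set) \<Rightarrow> (nat \<Rightarrow> real set) \<Rightarrow> real) \<Rightarrow> bool"
  where "compatible_metric d \<longleftrightarrow>
    Metric_space solenoid d \<and> Metric_space.mtopology solenoid d = solenoid_top"


section \<open>Basic facts\<close>

lemma comm_group_real_group: "comm_group real_group"
proof (rule comm_groupI)
  fix x assume "x \<in> carrier real_group"
  show "\<exists>y\<in>carrier real_group. y \<otimes>\<^bsub>real_group\<^esub> x = \<one>\<^bsub>real_group\<^esub>"
    by (rule bexI[of _ "- x"]) (auto simp: real_group_def)
qed (auto simp: real_group_def)

lemma in_cls_iff: "y \<in> cls n x \<longleftrightarrow> (\<exists>k::int. y = x + real n * of_int k)"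
  by (auto simp: cls_def r_coset_def multiples_def real_group_def add.commute)

lemma cls_eq_iff: "cls n x = cls n y \<longleftrightarrow> (\<exists>k::int. y = x + real n * of_int k)"
proof
  assume "cls n x = cls n y"
  moreover have "y \<in> cls n y" by (auto simp: in_cls_iff intro: exI[of _ 0])
  ultimately show "\<exists>k::int. y = x + real n * of_int k" using in_cls_iff by auto
next
  assume "\<exists>k::int. y = x + real n * of_int k"
  then obtain k :: int where k: "y = x + real n * of_int k" by auto
  show "cls n x = cls n y"
  proof (intro equalityI subsetI)
    fix z assume "z \<in> cls n x"
    then obtain l :: int where "z = x + real n * of_int l" by (auto simp: in_cls_iff)
    then show "z \<in> cls n y"
      unfolding in_cls_iff by (intro exI[of _ "l - k"]) (simp add: k algebra_simps)
  next
    fix z assume "z \<in> cls n y"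
    then obtain l :: int where "z = y + real n * of_int l" by (auto simp: in_cls_iff)
    then show "z \<in> cls n x"
      unfolding in_cls_iff by (intro exI[of _ "l + k"]) (simp add: k algebra_simps)
  qed
qed

lemma carrier_circle_group: "carrier (circle_group n) = range (cls n)"
  by (auto simp: circle_group_def FactGroup_def RCOSETS_def cls_def real_group_def)

lemma subgroup_multiples: "subgroup (multiples n) real_group"
proof (rule group.subgroupI)
  show "group real_group" using comm_group_real_group by (simp add: comm_group_def)
next
  fix a assume "a \<in> multiples n"
  then obtain k :: int where k: "a = real n * of_int k" by (auto simp: multiples_def)
  have "inv\<^bsub>real_group\<^esub> a = - a"
    using comm_group_real_group
    by (intro group.inv_equality) (auto simp: comm_group_def real_group_def)
  also have "\<dots> = real n * of_int (- k)" by (simp add: k)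
  finally show "inv\<^bsub>real_group\<^esub> a \<in> multiples n" unfolding multiples_def by blast
next
  fix a b assume "a \<in> multiples n" "b \<in> multiples n"
  then obtain k l :: int where "a = real n * of_int k" "b = real n * of_int l"
    by (auto simp: multiples_def)
  then have "a \<otimes>\<^bsub>real_group\<^esub> b = real n * of_int (k + l)"
    by (simp add: real_group_def algebra_simps)
  then show "a \<otimes>\<^bsub>real_group\<^esub> b \<in> multiples n" unfolding multiples_def by blast
qed (auto simp: real_group_def multiples_def)

lemma normal_multiples: "multiples n \<lhd> real_group"
  using comm_group_real_group subgroup_multiples
  by (simp add: comm_group.subgroup_imp_normal)

lemma group_circle_group: "group (circle_group n)"
  unfolding circle_group_def by (rule normal.factorgroup_is_group[OF normal_multiples])

lemma mult_cls: "cls n x \<otimes>\<^bsub>circle_group n\<^esub> cls n y = cls n (x + y)"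
  using normal.rcos_sum[OF normal_multiples, of x y n]
  by (simp add: circle_group_def FactGroup_def cls_def real_group_def)

lemma bond_cls: "m dvd n \<Longrightarrow> bond m (cls n x) = cls m x"
proof -
  assume "m dvd n"
  then obtain j where j: "n = m * j" by auto
  have "cls m y = cls m x" if y: "y \<in> cls n x" for y
  proof -
    obtain k :: int where "y = x + real n * of_int k" using y by (auto simp: in_cls_iff)
    then have "y = x + real m * of_int (int j * k)" by (simp add: j)
    then show ?thesis using cls_eq_iff by metis
  qed
  moreover have "x \<in> cls n x" by (auto simp: in_cls_iff intro: exI[of _ 0])
  ultimately show ?thesis unfolding bond_def by blast
qed

lemma openin_circle_top:
  "openin (circle_top n) U \<longleftrightarrow> U \<subseteq> carrier (circle_group n) \<and> open {x. cls n x \<in> U}"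
proof -
  have "istopology (\<lambda>U. U \<subseteq> carrier (circle_group n) \<and> open {x. cls n x \<in> U})"
    unfolding istopology_def
  proof (intro conjI allI impI)
    fix S T
    assume "S \<subseteq> carrier (circle_group n) \<and> open {x. cls n x \<in> S}"
      and "T \<subseteq> carrier (circle_group n) \<and> open {x. cls n x \<in> T}"
    then show "open {x. cls n x \<in> S \<inter> T}"
      using open_Collect_conj by auto
  next
    fix K
    assume K: "\<forall>U\<in>K. U \<subseteq> carrier (circle_group n) \<and> open {x. cls n x \<in> U}"
    have "{x. cls n x \<in> \<Union>K} = (\<Union>U\<in>K. {x. cls n x \<in> U})" by blast
    also have "open \<dots>" using K by blast
    finally show "open {x. cls n x \<in> \<Union>K}" .
  qed blast+
  then show ?thesis unfolding circle_top_def by (simp add: topology_inverse')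
qed

lemma topspace_circle_top: "topspace (circle_top n) = carrier (circle_group n)"
proof
  show "topspace (circle_top n) \<subseteq> carrier (circle_group n)"
    unfolding topspace_def openin_circle_top by blast
  have "openin (circle_top n) (carrier (circle_group n))"
    by (simp add: openin_circle_top carrier_circle_group)
  then show "carrier (circle_group n) \<subseteq> topspace (circle_top n)"
    by (rule openin_subset)
qed

lemma quotient_map_cls: "quotient_map euclidean (circle_top n) (cls n)"
  by (auto simp: quotient_map_def topspace_circle_top carrier_circle_group openin_circle_top)

lemma topspace_solenoid_top: "topspace solenoid_top = solenoid"
  by (auto simp: solenoid_top_def solenoid_def topspace_circle_top)

lemma solenoid_sigma_in_solenoid: "solenoid_sigma t \<in> solenoid"
  by (auto simp: solenoid_sigma_def solenoid_def carrier_circle_group bond_cls)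

lemma solenoid_proj:
  assumes "s \<in> solenoid" "0 < m" "0 < n" "m dvd n" and x: "s n = cls n x"
  shows "s m = cls m x"
proof -
  have "s m = bond m (s n)" using assms(1-4) unfolding solenoid_def by blast
  then show ?thesis by (simp only: x bond_cls[OF assms(4)])
qed

lemma translate_apply: "0 < n \<Longrightarrow> s n = cls n x \<Longrightarrow> translate s t n = cls n (x + t)"
  by (simp add: translate_def solenoid_group_def product_group_def solenoid_sigma_def mult_cls)

lemma subgroup_solenoid: "subgroup solenoid (product_group {0<..} circle_group)"
proof (rule group.subgroupI)
  show "group (product_group {0<..} circle_group)"
    by (rule product_group) (rule group_circle_group)
  show "solenoid \<subseteq> carrier (product_group {0<..} circle_group)"
    by (auto simp: solenoid_def)
  show "solenoid \<noteq> {}" using solenoid_sigma_in_solenoid by blast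
next
  fix s assume s: "s \<in> solenoid"
  have inv_cls: "inv\<^bsub>circle_group n\<^esub> cls n x = cls n (- x)" for n x
  proof (rule group.inv_equality[OF group_circle_group])
    show "cls n (- x) \<otimes>\<^bsub>circle_group n\<^esub> cls n x = \<one>\<^bsub>circle_group n\<^esub>"
      unfolding mult_cls by (simp add: circle_group_def FactGroup_def cls_def r_coset_def real_group_def)
  qed (auto simp: carrier_circle_group)
  have sc: "s \<in> carrier (product_group {0<..} circle_group)" using s by (simp add: solenoid_def)
  have eq: "inv\<^bsub>product_group {0<..} circle_group\<^esub> s = (\<lambda>n\<in>{0<..}. inv\<^bsub>circle_group n\<^esub> s n)"
    by (rule inv_product_group) (use sc group_circle_group in auto)
  show "inv\<^bsub>product_group {0<..} circle_group\<^esub> s \<in> solenoid"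
    unfolding solenoid_def
  proof (intro CollectI conjI allI impI)
    show "inv\<^bsub>product_group {0<..} circle_group\<^esub> s \<in> carrier (product_group {0<..} circle_group)"
      unfolding eq using sc by (auto simp: PiE_iff intro!: group.inv_closed group_circle_group)
  next
    fix m n :: nat assume mn: "0 < m" "0 < n" "m dvd n"
    obtain x where x: "s n = cls n x"
      using sc mn by (auto simp: PiE_iff carrier_circle_group)
    have "s m = cls m x" using solenoid_proj[OF s _ _ _ x] mn by blast
    then show "(inv\<^bsub>product_group {0<..} circle_group\<^esub> s) m =
        bond m ((inv\<^bsub>product_group {0<..} circle_group\<^esub> s) n)"
      using mn by (simp add: eq x inv_cls bond_cls)
  qed
next
  fix s t assume st: "s \<in> solenoid" "t \<in> solenoid"
  then have stc: "s \<in> carrier (product_group {0<..} circle_group)"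
      "t \<in> carrier (product_group {0<..} circle_group)" by (simp_all add: solenoid_def)
  show "s \<otimes>\<^bsub>product_group {0<..} circle_group\<^esub> t \<in> solenoid"
    unfolding solenoid_def
  proof (intro CollectI conjI allI impI)
    show "s \<otimes>\<^bsub>product_group {0<..} circle_group\<^esub> t \<in> carrier (product_group {0<..} circle_group)"
      using stc by (auto simp: PiE_iff carrier_circle_group)
        (metis greaterThan_iff mult_cls rangeE rangeI)
  next
    fix m n :: nat assume mn: "0 < m" "0 < n" "m dvd n"
    obtain x y where x: "s n = cls n x" and y: "t n = cls n y"
      using stc mn unfolding carrier_product_group PiE_iff carrier_circle_group
      by (metis greaterThan_iff rangeE)
    have "s m = cls m x" "t m = cls m y"
      using solenoid_proj[OF st(1) _ _ _ x] solenoid_proj[OF st(2) _ _ _ y] mn by blast+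
    then show "(s \<otimes>\<^bsub>product_group {0<..} circle_group\<^esub> t) m =
        bond m ((s \<otimes>\<^bsub>product_group {0<..} circle_group\<^esub> t) n)"
      using mn by (simp add: x y mult_cls bond_cls)
  qed
qed

lemma group_solenoid_group: "group solenoid_group"
  unfolding solenoid_group_def
  by (intro group.subgroup_imp_group subgroup_solenoid) (simp add: group_circle_group)

text \<open>\<^const>\<open>solenoid_top\<close> is compact and metrizable, so compatible metrics do exist.\<close>

definition circle_emb :: "nat \<Rightarrow> real set \<Rightarrow> complex"
  where "circle_emb n A = cis (2 * pi * (SOME x. x \<in> A) / real n)"

lemma circle_emb_cls: "0 < n \<Longrightarrow> circle_emb n (cls n x) = cis (2 * pi * x / real n)"
proof -
  assume n: "0 < n"
  have "x \<in> cls n x" by (auto simp: in_cls_iff intro: exI[of _ 0])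
  then have "(SOME y. y \<in> cls n x) \<in> cls n x" by (rule someI)
  then obtain k :: int where k: "(SOME y. y \<in> cls n x) = x + real n * of_int k"
    by (auto simp: in_cls_iff)
  have "2 * pi * (x + real n * of_int k) / real n = 2 * pi * x / real n + 2 * pi * of_int k"
    using n by (simp add: field_simps)
  then have "circle_emb n (cls n x) = cis (2 * pi * x / real n) * cis (2 * pi * of_int k)"
    by (simp only: circle_emb_def k cis_mult)
  then show ?thesis by (simp add: cis_multiple_2pi)
qed

lemma circle_emb_eq_iff:
  assumes n: "0 < n"
  shows "circle_emb n (cls n x) = circle_emb n (cls n y) \<longleftrightarrow> cls n x = cls n y"
proof
  assume "circle_emb n (cls n x) = circle_emb n (cls n y)"
  then have e: "cis (2 * pi * x / real n) = cis (2 * pi * y / real n)"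
    by (simp add: circle_emb_cls n)
  have "sin (2 * pi * y / real n) = sin (2 * pi * x / real n)"
    "cos (2 * pi * y / real n) = cos (2 * pi * x / real n)"
    using arg_cong[OF e, of Im] arg_cong[OF e, of Re] by simp_all
  then obtain k :: int where "2 * pi * y / real n = 2 * pi * x / real n + 2 * pi * of_int k"
    using sin_cos_eq_iff[of "2 * pi * y / real n" "2 * pi * x / real n"] by auto
  then have "2 * pi * y = 2 * pi * (x + real n * of_int k)"
    using n by (simp add: field_simps)
  then have "y = x + real n * of_int k" by simp
  then show "cls n x = cls n y" using cls_eq_iff by blast
qed simp

lemma continuous_map_circle_emb:
  assumes "0 < n"
  shows "continuous_map (circle_top n) euclidean (circle_emb n)"
proof -
  have "continuous_map euclidean euclidean (circle_emb n \<circ> cls n)"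
    using assms by (auto simp: o_def circle_emb_cls intro!: continuous_intros)
  then show ?thesis
    using continuous_compose_quotient_map_eq[OF quotient_map_cls] by blast
qed

lemma compact_circle_top:
  assumes "0 < n"
  shows "compact_space (circle_top n)"
proof -
  have "cls n x \<in> cls n ` {0..real n}" for x
  proof (rule image_eqI)
    have "cls n x = cls n (x + real n * of_int (- \<lfloor>x / real n\<rfloor>))"
      using cls_eq_iff by blast
    then show "cls n x = cls n (x - real n * of_int \<lfloor>x / real n\<rfloor>)" by simp
    have "real n * of_int \<lfloor>x / real n\<rfloor> \<le> real n * (x / real n)"
      "real n * (x / real n) \<le> real n * (of_int \<lfloor>x / real n\<rfloor> + 1)"
      by (rule mult_left_mono; linarith)+
    then show "x - real n * of_int \<lfloor>x / real n\<rfloor> \<in> {0..real n}"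
      using assms by (simp add: distrib_left)
  qed
  then have "cls n ` {0..real n} = topspace (circle_top n)"
    by (auto simp: topspace_circle_top carrier_circle_group)
  moreover have "compactin (circle_top n) (cls n ` {0..real n})"
    by (rule image_compactin[OF _ quotient_imp_continuous_map[OF quotient_map_cls]])
       (simp add: compactin_euclidean_iff)
  ultimately show ?thesis by (simp add: compact_space_def)
qed

lemma continuous_map_circle_emb_proj:
  assumes "0 < n"
  shows "continuous_map (product_topology circle_top {0<..}) euclidean (\<lambda>s. circle_emb n (s n))"
proof -
  have "continuous_map (product_topology circle_top {0<..}) (circle_top n) (\<lambda>s. s n)"
    using assms by (intro continuous_map_product_projection) simp
  from continuous_map_compose[OF this continuous_map_circle_emb[OF assms]]
  show ?thesis by (simp add: o_def)
qed

lemma solenoid_emb: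
  "solenoid = {s \<in> topspace (product_topology circle_top {0<..}).
     \<forall>m n. 0 < m \<longrightarrow> 0 < n \<longrightarrow> m dvd n \<longrightarrow> circle_emb m (s m) - circle_emb n (s n) ^ (n div m) = 0}"
proof -
  have eq: "s m = bond m (s n) \<longleftrightarrow> circle_emb m (s m) - circle_emb n (s n) ^ (n div m) = 0"
    if s: "s \<in> (\<Pi>\<^sub>E i\<in>{0<..}. range (cls i))" and mn: "0 < m" "0 < n" "m dvd n"
    for s and m n :: nat
  proof -
    have "s m \<in> range (cls m)" "s n \<in> range (cls n)" using s mn by (auto simp: PiE_iff)
    then obtain x y where xy: "s m = cls m x" "s n = cls n y" by blast
    obtain j where j: "n = m * j" using mn by auto
    have "real (n div m) * (2 * pi * y / real n) = 2 * pi * y / real m"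
      using mn by (simp add: j field_simps)
    then have "circle_emb n (s n) ^ (n div m) = circle_emb m (cls m y)"
      by (simp only: xy circle_emb_cls mn Complex.DeMoivre)
    then show ?thesis using circle_emb_eq_iff[OF mn(1)] mn by (simp add: xy bond_cls)
  qed
  have top: "topspace (product_topology circle_top {0<..}) = (\<Pi>\<^sub>E i\<in>{0<..}. range (cls i))"
    by (simp add: topspace_circle_top carrier_circle_group)
  show ?thesis
    unfolding solenoid_def top carrier_product_group carrier_circle_group
    by (intro Collect_cong conj_cong refl all_cong1 imp_cong eq)
qed

lemma compact_solenoid_top: "compact_space solenoid_top"
proof -
  let ?P = "product_topology circle_top {0<..}"
  have cl: "closedin ?P {s \<in> topspace ?P. circle_emb m (s m) - circle_emb n (s n) ^ (n div m) \<in> {0}}"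
    if "0 < m" "0 < n" for m n
  proof (intro closedin_continuous_map_preimage[where Y = euclidean] continuous_map_diff)
    show "continuous_map ?P euclidean (\<lambda>s. circle_emb m (s m))"
      using that by (intro continuous_map_circle_emb_proj)
    have "continuous_map euclidean euclidean (\<lambda>z::complex. z ^ (n div m))"
      by (auto intro!: continuous_intros)
    from continuous_map_compose[OF continuous_map_circle_emb_proj[OF that(2)] this]
    show "continuous_map ?P euclidean (\<lambda>s. circle_emb n (s n) ^ (n div m))"
      by (simp add: o_def)
  qed auto
  let ?C = "{C. \<exists>m n. 0 < m \<and> 0 < n \<and> m dvd n \<and>
    C = {s \<in> topspace ?P. circle_emb m (s m) - circle_emb n (s n) ^ (n div m) \<in> {0}}}"
  have ne: "?C \<noteq> {}" using dvd_refl[of "1::nat"] zero_less_one by blast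
  have "closedin ?P (\<Inter>?C)" by (rule closedin_Inter[OF ne]) (use cl in blast)
  moreover have "solenoid = \<Inter>?C"
  proof (rule Set.set_eqI)
    fix s
    have "s \<in> \<Inter>?C \<longleftrightarrow> (\<forall>m n. 0 < m \<longrightarrow> 0 < n \<longrightarrow> m dvd n \<longrightarrow>
        s \<in> topspace ?P \<and> circle_emb m (s m) - circle_emb n (s n) ^ (n div m) = 0)"
      by blast
    also have "\<dots> \<longleftrightarrow> s \<in> solenoid"
      unfolding solenoid_emb using dvd_refl[of "1::nat"] zero_less_one by blast
    finally show "s \<in> solenoid \<longleftrightarrow> s \<in> \<Inter>?C" by simp
  qed
  ultimately have "closedin ?P solenoid" by simp
  moreover have "compact_space ?P"
    unfolding compact_space_product_topology by (auto intro: compact_circle_top)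
  ultimately show ?thesis
    unfolding solenoid_top_def by (intro compact_space_subtopology closedin_compact_space)
qed

lemma metrizable_solenoid_top: "metrizable_space solenoid_top"
proof -
  define e :: "(nat \<Rightarrow> real set) \<Rightarrow> nat \<Rightarrow> complex"
    where "e s n = (if 0 < n then circle_emb n (s n) else 0)" for s n
  have "continuous_map solenoid_top (product_topology (\<lambda>_. euclidean) UNIV) e"
    unfolding continuous_map_componentwise_UNIV
  proof
    fix n
    show "continuous_map solenoid_top euclidean (\<lambda>s. e s n)"
      by (cases "0 < n")
         (auto simp: e_def solenoid_top_def
           intro: continuous_map_from_subtopology continuous_map_circle_emb_proj)
  qed
  then have ct: "continuous_map solenoid_top euclidean e"
    by (simp add: euclidean_product_topology)
  have "inj_on e (topspace solenoid_top)"
  proof (rule inj_onI)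
    fix s t assume st: "s \<in> topspace solenoid_top" "t \<in> topspace solenoid_top" "e s = e t"
    then have st': "s \<in> (\<Pi>\<^sub>E i\<in>{0<..}. range (cls i))" "t \<in> (\<Pi>\<^sub>E i\<in>{0<..}. range (cls i))"
      by (simp_all add: topspace_solenoid_top solenoid_def carrier_circle_group)
    show "s = t"
    proof (rule PiE_ext[OF st'])
      fix n :: nat assume n: "n \<in> {0<..}"
      then have "s n \<in> range (cls n)" "t n \<in> range (cls n)" using st' by (auto simp: PiE_iff)
      moreover have "circle_emb n (s n) = circle_emb n (t n)"
        using fun_cong[OF st(3), of n] n by (simp add: e_def)
      ultimately show "s n = t n" using circle_emb_eq_iff n by auto
    qed
  qed
  then have "embedding_map solenoid_top euclidean e"
    by (intro continuous_imp_embedding_map ct compact_solenoid_top) simp_all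
  then have "solenoid_top homeomorphic_space subtopology euclidean (e ` topspace solenoid_top)"
    by (rule embedding_map_imp_homeomorphic_space)
  then show ?thesis
    using homeomorphic_metrizable_space metrizable_space_euclidean metrizable_space_subtopology
    by blast
qed

lemma compatible_metric_exists: "\<exists>d. compatible_metric d"
proof -
  obtain M d where "Metric_space M d" and d: "solenoid_top = Metric_space.mtopology M d"
    using metrizable_solenoid_top by (auto simp: metrizable_space_def)
  moreover from this have "M = solenoid"
    using Metric_space.topspace_mtopology topspace_solenoid_top by metis
  ultimately show ?thesis unfolding compatible_metric_def by metis
qed

end

(* A map induced by F moves the point s along its leaf by F x - x, where x is any lift of the
   projection of s to R/Z; hence f^n s = s + sigma(F^n x - x), and the dynamics of f on S is
   that of F on the line. If the rotation number is p/q, then F^q - p is monotone with bounded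
   orbits, so the orbit of x converges to a fixed point y, and s + sigma(y - x) is fiber periodic;
   small leafwise displacements are uniformly small in S by compactness. If the rotation
   number r is irrational, h x = limsup (F^n x - n r) is monotone with h (F x) = h x + r; its range
   contains the dense set h 0 + N r + Z, so h is continuous and induces the semiconjugacy. *)
theory Submission
  imports Defs
begin

section \<open>Poincare's rotation theory for monotone maps of the line\<close>

section \<open>Monotone maps of degree one\<close>

text \<open>Neither continuity nor monotonicity is built in, so that lifts, their iterates and the
  semiconjugacy \<open>h\<close>, whose continuity is proved separately, are all covered.\<close>

definition degree_one :: "(real \<Rightarrow> real) \<Rightarrow> bool"
  where "degree_one G \<longleftrightarrow> (\<forall>x. G (x + 1) = G x + 1)"

lemma degree_one_of_int:
  assumes "degree_one G"
  shows "G (x + of_int k) = G x + of_int k"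
proof (induction k rule: int_induct[where k = 0])
  case (step1 i)
  have "G (x + of_int (i + 1)) = G (x + of_int i + 1)" by (simp add: add.assoc)
  then show ?case using assms step1 by (simp add: degree_one_def)
next
  case (step2 i)
  have "G (x + of_int (i - 1) + 1) = G (x + of_int (i - 1)) + 1"
    using assms by (simp only: degree_one_def)
  then show ?case using step2 by simp
qed simp

lemma degree_one_funpow: "degree_one G \<Longrightarrow> degree_one (G ^^ n)"
  by (induction n) (simp_all add: degree_one_def)

text \<open>\<open>G x\<close> is squeezed between the values of \<open>G\<close> at the two
  integers around \<open>x\<close>, which are \<open>G 0\<close> plus these integers.\<close>

lemma mono_degree_one_displacement:
  assumes "mono G" "degree_one G"
  shows "\<bar>G x - x - G 0\<bar> \<le> 1"
proof -
  have "G (0 + of_int \<lfloor>x\<rfloor>) \<le> G x" "G x \<le> G (0 + of_int (\<lfloor>x\<rfloor> + 1))"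
    by (rule monoD[OF assms(1)]; linarith)+
  then have "G 0 + of_int \<lfloor>x\<rfloor> \<le> G x" "G x \<le> G 0 + of_int (\<lfloor>x\<rfloor> + 1)"
    by (simp_all only: degree_one_of_int[OF assms(2)])
  then show ?thesis by linarith
qed

text \<open>Split the orbit of 0 into \<open>n\<close> blocks of \<open>m\<close> steps: each block
  moves its starting point by \<open>(G ^^ m) 0\<close> up to an error of 1.\<close>

lemma funpow_mult_displacement:
  assumes "mono G" "degree_one G"
  shows "\<bar>(G ^^ (n * m)) 0 - real n * (G ^^ m) 0\<bar> \<le> real n"
proof (induction n)
  case (Suc n)
  have "\<bar>(G ^^ m) ((G ^^ (n * m)) 0) - (G ^^ (n * m)) 0 - (G ^^ m) 0\<bar> \<le> 1"
    by (intro mono_degree_one_displacement mono_pow degree_one_funpow assms)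
  then show ?case using Suc by (simp add: funpow_add distrib_right)
qed simp

text \<open>Quasi-additivity puts every \<open>(a\<^sub>n - 1) / n\<close> below every \<open>(a\<^sub>m + 1) / m\<close>,
  where \<open>a\<^sub>n = G\<^sup>n 0\<close>; the rotation number is the supremum of the former.\<close>

lemma displacement_bound_exists:
  assumes "mono G" "degree_one G"
  obtains r where "\<And>n x. \<bar>(G ^^ n) x - x - real n * r\<bar> \<le> 2"
proof -
  define a where "a n = (G ^^ n) 0" for n
  have le: "(a n - 1) / real n \<le> (a m + 1) / real m" if "0 < n" "0 < m" for n m
  proof -
    \<comment> \<open>The displacement \<open>a (n * m)\<close> lies between the two sides: it is
      \<open>m\<close> blocks of length \<open>n\<close> and also \<open>n\<close> blocks of length
      \<open>m\<close>.\<close>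
    have "real m * (a n - 1) \<le> real n * (a m + 1)"
      using funpow_mult_displacement[OF assms, of m n] funpow_mult_displacement[OF assms, of n m]
      by (simp add: a_def mult.commute[of n m] right_diff_distrib distrib_left)
    then show ?thesis using that by (simp add: field_simps)
  qed
  define r where "r = (SUP n\<in>{0<..}. (a n - 1) / real n)"
  have bdd: "bdd_above ((\<lambda>n. (a n - 1) / real n) ` {0<..})"
    using le[of _ 1] by (intro bdd_aboveI2[where M = "(a 1 + 1) / real 1"]) auto
  have "\<bar>a n - real n * r\<bar> \<le> 1" for n
  proof (cases "n = 0")
    case False
    have "(a n - 1) / real n \<le> r"
      unfolding r_def using False by (intro cSUP_upper[OF _ bdd]) simp
    moreover have "r \<le> (a n + 1) / real n"
      unfolding r_def using False by (intro cSUP_least le) auto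
    ultimately show ?thesis using False by (simp add: field_simps)
  qed (simp add: a_def)
  moreover have "\<bar>(G ^^ n) x - x - a n\<bar> \<le> 1" for n x
    unfolding a_def by (intro mono_degree_one_displacement mono_pow degree_one_funpow assms)
  ultimately have "\<bar>(G ^^ n) x - x - a n\<bar> + \<bar>a n - real n * r\<bar> \<le> 1 + 1" for n x
    by (intro add_mono)
  then have "\<bar>(G ^^ n) x - x - real n * r\<bar> \<le> 2" for n x
    using abs_triangle_ineq[of "(G ^^ n) x - x - a n" "a n - real n * r"] by (smt (verit))
  then show thesis by (rule that)
qed

text \<open>The uniform bound makes the averages converge with error at most
  \<open>2 / real n\<close>, so the description in \<open>rotation_number\<close> is well defined.
  Later arguments use this bound rather than the limit.\<close>

lemma rotation_number_displacement:
  assumes "mono G" "degree_one G"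
  shows "\<bar>(G ^^ n) x - x - real n * rotation_number G\<bar> \<le> 2"
proof -
  obtain r where r: "\<bar>(G ^^ n) x - x - real n * r\<bar> \<le> 2" for n x
    using displacement_bound_exists[OF assms] by blast
  have lim: "(\<lambda>n. ((G ^^ n) x - x) / real n) \<longlonglongrightarrow> r" for x
  proof (rule LIM_zero_cancel, rule Lim_null_comparison)
    show "\<forall>\<^sub>F n in sequentially. norm (((G ^^ n) x - x) / real n - r) \<le> 2 / real n"
      using eventually_gt_at_top[of 0]
    proof eventually_elim
      case (elim n)
      then have "((G ^^ n) x - x) / real n - r = ((G ^^ n) x - x - real n * r) / real n"
        by (simp add: field_simps)
      then show ?case using r[of n x] elim by (simp add: divide_right_mono)
    qed
    show "(\<lambda>n. 2 / real n) \<longlonglongrightarrow> 0" by (rule lim_const_over_n)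
  qed
  have "rotation_number G = r"
    unfolding rotation_number_def
    by (rule the_equality) (use lim LIMSEQ_unique in blast)+
  then show ?thesis using r by simp
qed

text \<open>The comparison of \<open>x\<close> with \<open>G x\<close> propagates along the orbit,
  which is therefore monotone; being bounded it converges, and continuity makes the limit a fixed
  point.\<close>

lemma mono_bounded_orbit_tendsto_fixpoint:
  fixes G :: "real \<Rightarrow> real"
  assumes mono: "mono G" and cont: "continuous_on UNIV G"
    and bounded: "\<And>n. \<bar>(G ^^ n) x\<bar> \<le> B"
  obtains y where "G y = y" "(\<lambda>n. (G ^^ n) x) \<longlonglongrightarrow> y"
proof -
  have "monoseq (\<lambda>n. (G ^^ n) x)"
  proof (cases "x \<le> G x")
    case True
    then have "(G ^^ n) x \<le> (G ^^ Suc n) x" for n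
      by (simp only: funpow_Suc_right o_apply) (intro monoD[OF mono_pow[OF mono]])
    then show ?thesis by (simp add: monoseq_Suc)
  next
    case False
    then have "(G ^^ Suc n) x \<le> (G ^^ n) x" for n
      by (simp only: funpow_Suc_right o_apply) (intro monoD[OF mono_pow[OF mono]], simp)
    then show ?thesis by (simp add: monoseq_Suc)
  qed
  moreover have "Bseq (\<lambda>n. (G ^^ n) x)"
    using bounded by (intro BseqI'[where K = B]) simp
  ultimately obtain y where y: "(\<lambda>n. (G ^^ n) x) \<longlonglongrightarrow> y"
    using Bseq_monoseq_convergent convergent_def by blast
  have "isCont G y" using cont by (simp add: continuous_on_eq_continuous_at)
  then have "(\<lambda>n. G ((G ^^ n) x)) \<longlonglongrightarrow> G y" using y by (rule isCont_tendsto_compose)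
  moreover have "(\<lambda>n. G ((G ^^ n) x)) \<longlonglongrightarrow> y" using LIMSEQ_Suc[OF y] by simp
  ultimately have "G y = y" by (rule LIMSEQ_unique)
  then show thesis using y that by blast
qed

text \<open>With a lim sup, rather than a supremum over the full orbit, no inverse of \<open>G\<close> is needed.\<close>

lemma mono_semiconjugacy_exists:
  assumes "mono G" "degree_one G"
  obtains h where "mono h" "degree_one h" "\<And>x. h (G x) = h x + rotation_number G"
proof -
  define r where "r = rotation_number G"
  define u where "u x n = ereal ((G ^^ n) x - real n * r)" for x n
  define h where "h x = real_of_ereal (limsup (u x))" for x
  have ub: "u x n \<le> ereal (x + 2)" "ereal (x - 2) \<le> u x n" for x n
    using rotation_number_displacement[OF assms, of n x] by (auto simp: u_def r_def)
  have "limsup (u x) \<le> ereal (x + 2)" for x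
    by (rule Limsup_bounded) (simp add: ub)
  moreover have "ereal (x - 2) \<le> limsup (u x)" for x
    by (rule le_Limsup) (simp_all add: ub)
  \<comment> \<open>The uniform displacement bound keeps the lim sup finite, so
    \<open>real_of_ereal\<close> loses nothing.\<close>
  ultimately have "\<bar>limsup (u x)\<bar> \<noteq> \<infinity>" for x
    by (metis MInfty_neq_ereal(1) PInfty_neq_ereal(1) abs_ereal.elims ereal_infty_less_eq(1)
        ereal_infty_less_eq2(2) ereal_less_eq(1) ereal_less_eq(2))
  then have h: "limsup (u x) = ereal (h x)" for x
    by (simp add: h_def ereal_real')
  have "h x \<le> h y" if "x \<le> y" for x y
  proof -
    have "limsup (u x) \<le> limsup (u y)"
      by (rule Limsup_mono) (simp add: u_def monoD[OF mono_pow[OF assms(1)] that])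
    then show ?thesis by (simp add: h)
  qed
  then have "mono h" by (rule monoI)
  moreover have "h (x + 1) = h x + 1" for x
  proof -
    have "u (x + 1) n = u x n + ereal 1" for n
      using degree_one_funpow[OF assms(2), of n] by (simp add: u_def degree_one_def)
    then have "limsup (u (x + 1)) = limsup (\<lambda>n. u x n + ereal 1)" by presburger
    also have "\<dots> = limsup (u x) + ereal 1"
      by (rule Limsup_add_ereal_right) simp_all
    finally have "limsup (u (x + 1)) = limsup (u x) + ereal 1" .
    then show ?thesis by (simp add: h)
  qed
  moreover have "h (G x) = h x + r" for x
  proof -
    \<comment> \<open>Starting one step later shifts the index, which the lim sup ignores, and
      \<open>u x (n + 1)\<close> subtracts one \<open>r\<close> too many.\<close>
    have "u (G x) n = u x (n + 1) + ereal r" for n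
      by (simp add: u_def funpow_swap1 algebra_simps)
    then have "limsup (u (G x)) = limsup (\<lambda>n. u x (n + 1) + ereal r)" by presburger
    also have "\<dots> = limsup (u x) + ereal r"
      by (subst Limsup_add_ereal_right) (simp_all only: limsup_shift, simp_all)
    finally show ?thesis by (simp add: h)
  qed
  ultimately show thesis using that by (simp add: degree_one_def r_def)
qed

text \<open>A monotone function can only fail to be continuous by a jump, and a dense range leaves
  no gap for one.\<close>

lemma mono_dense_range_continuous:
  fixes h :: "real \<Rightarrow> real"
  assumes "mono h" and dense: "\<And>a b. a < b \<Longrightarrow> \<exists>x. a < h x \<and> h x < b"
  shows "continuous_on UNIV h"
  unfolding continuous_on_iff
proof (intro ballI allI impI)
  fix x e :: real assume "0 < e"
  then obtain y z where y: "h x - e < h y" "h y < h x" and z: "h x < h z" "h z < h x + e"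
    using dense[of "h x - e" "h x"] dense[of "h x" "h x + e"] by auto
  have yz: "y < x" "x < z" using y(2) z(1) assms(1) by (meson leD leI monoD)+
  show "\<exists>d>0. \<forall>w\<in>UNIV. dist w x < d \<longrightarrow> dist (h w) (h x) < e"
  proof (intro exI conjI ballI impI)
    show "0 < min (x - y) (z - x)" using yz by simp
    fix w assume "dist w x < min (x - y) (z - x)"
    then have "y \<le> w" "w \<le> z" by (auto simp: dist_real_def)
    then have "h y \<le> h w" "h w \<le> h z" using assms(1) by (auto dest: monoD)
    then show "dist (h w) (h x) < e" using y z by (simp add: dist_real_def)
  qed
qed

text \<open>The values at the integers are \<open>h 0\<close> plus integers, so any \<open>y\<close>
  lies between two consecutive ones and the intermediate value theorem applies.\<close>

lemma degree_one_surj: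
  assumes "degree_one h" "continuous_on UNIV h"
  shows "surj h"
  unfolding surj_def
proof
  fix y
  have "h (0 + of_int \<lfloor>y - h 0\<rfloor>) \<le> y" "y \<le> h (0 + of_int (\<lfloor>y - h 0\<rfloor> + 1))"
    unfolding degree_one_of_int[OF assms(1)] by linarith+
  then show "\<exists>x. y = h x"
    using IVT'[of h _ y] continuous_on_subset[OF assms(2)] by force
qed

lemma irrational_semiconjugacy_continuous:
  assumes "degree_one h" "mono h" and semi: "\<And>x. h (G x) = h x + r" and "r \<notin> \<rat>"
  shows "continuous_on UNIV h"
proof (rule mono_dense_range_continuous)
  fix a b :: real assume "a < b"
  have iter: "h ((G ^^ n) x) = h x + real n * r" for n x
    by (induction n) (simp_all add: semi algebra_simps)
  \<comment> \<open>Kronecker density, aimed at the midpoint of the interval with half its length as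
    tolerance. Positivity of \<open>k\<close> matters, since only forward iterates of
    \<open>G\<close> are available.\<close>
  obtain m k where k: "k > 0"
    and *: "\<bar>of_int k * r - of_int m - ((a + b) / 2 - h 0)\<bar> < (b - a) / 2"
    using sequence_of_fractional_parts_is_dense[OF assms(4), of "(b - a) / 2" "(a + b) / 2 - h 0"]
      \<open>a < b\<close> by (metis diff_gt_0_iff_gt half_gt_zero)
  have "h ((G ^^ nat k) 0 + of_int (- m)) = h 0 + of_int k * r - of_int m"
    using k by (simp only: degree_one_of_int[OF assms(1)] iter) simp
  then show "\<exists>x. a < h x \<and> h x < b" using * by (intro exI[of _ "(G ^^ nat k) 0 + of_int (- m)"]) argo
qed (fact assms)

section \<open>The translation flow along the leaves and its continuity\<close>

section \<open>Translations of the solenoid\<close>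

lemma solenoid_PiE: "s \<in> solenoid \<Longrightarrow> s \<in> (\<Pi>\<^sub>E n\<in>{0<..}. range (cls n))"
  by (simp add: solenoid_def carrier_circle_group)

lemma solenoid_coordinate:
  assumes "s \<in> solenoid" "0 < n"
  obtains x where "s n = cls n x"
  using solenoid_PiE[OF assms(1)] assms(2) by (auto simp: PiE_iff)

lemma solenoid_proj_1: "s \<in> solenoid \<Longrightarrow> 0 < n \<Longrightarrow> s n = cls n x \<Longrightarrow> s 1 = cls 1 x"
  by (rule solenoid_proj) simp_all

lemma solenoid_eqI:
  assumes "s \<in> solenoid" "t \<in> solenoid" and "\<And>n x. 0 < n \<Longrightarrow> s n = cls n x \<Longrightarrow> t n = cls n x"
  shows "s = t"
proof (rule PiE_ext)
  show "s \<in> (\<Pi>\<^sub>E n\<in>{0<..}. range (cls n))" "t \<in> (\<Pi>\<^sub>E n\<in>{0<..}. range (cls n))"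
    using assms(1,2) by (simp_all only: solenoid_PiE)
  fix n :: nat assume "n \<in> {0<..}"
  then have n: "0 < n" by simp
  then obtain x where "s n = cls n x" by (rule solenoid_coordinate[OF assms(1)])
  with assms(3)[OF n] show "s n = t n" by simp
qed

lemma translate_in_solenoid: "s \<in> solenoid \<Longrightarrow> translate s t \<in> solenoid"
  using group.is_monoid[OF group_solenoid_group] solenoid_sigma_in_solenoid[of t]
    monoid.m_closed[of solenoid_group s "solenoid_sigma t"]
  by (simp add: translate_def solenoid_group_def)

lemma translate_0: "s \<in> solenoid \<Longrightarrow> translate s 0 = s"
  by (rule solenoid_eqI[symmetric]) (simp_all add: translate_in_solenoid translate_apply)

lemma translate_translate: "s \<in> solenoid \<Longrightarrow> translate (translate s a) b = translate s (a + b)"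
proof (rule solenoid_eqI)
  fix n x assume s: "s \<in> solenoid" and n: "0 < n" and x: "translate (translate s a) b n = cls n x"
  obtain z where z: "s n = cls n z" by (rule solenoid_coordinate[OF s n])
  show "translate s (a + b) n = cls n x"
    using n x z by (simp add: translate_apply[where x = "z + a"] translate_apply add.assoc)
qed (simp_all add: translate_in_solenoid)

lemma continuous_map_mult:
  fixes f g :: "'a \<Rightarrow> 'b::real_normed_algebra"
  shows "continuous_map X euclidean f \<Longrightarrow> continuous_map X euclidean g \<Longrightarrow>
    continuous_map X euclidean (\<lambda>x. f x * g x)"
  by (simp add: continuous_map_atin tendsto_mult)

text \<open>On the compact circle \<open>circle_emb n\<close> is an embedding into the complex
  plane, so continuity can be tested after composing with it.\<close>

lemma continuous_map_into_circle:
  assumes n: "0 < n" and g: "g \<in> topspace X \<rightarrow> topspace (circle_top n)"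
    and cont: "continuous_map X euclidean (\<lambda>x. circle_emb n (g x))"
  shows "continuous_map X (circle_top n) g"
proof -
  let ?e = "circle_emb n" and ?C = "topspace (circle_top n)"
  have inj: "inj_on ?e ?C"
    using circle_emb_eq_iff[OF n] by (auto simp: inj_on_def topspace_circle_top carrier_circle_group)
  have "embedding_map (circle_top n) euclidean ?e"
    by (intro continuous_imp_embedding_map inj continuous_map_circle_emb compact_circle_top n) simp_all
  then obtain e' where e': "homeomorphic_maps (circle_top n) (subtopology euclidean (?e ` ?C)) ?e e'"
    unfolding embedding_map_def homeomorphic_map_maps by blast
  have "continuous_map X (subtopology euclidean (?e ` ?C)) (\<lambda>x. ?e (g x))"
    using cont g by (auto simp: continuous_map_in_subtopology)
  then have "continuous_map X (circle_top n) (e' \<circ> (\<lambda>x. ?e (g x)))"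
    using e' unfolding homeomorphic_maps_def by (blast intro: continuous_map_compose)
  then show ?thesis
    by (rule continuous_map_eq) (use e' g in \<open>auto simp: homeomorphic_maps_def\<close>)
qed

lemma continuous_map_into_solenoid:
  assumes "\<And>x. x \<in> topspace X \<Longrightarrow> g x \<in> solenoid"
    and "\<And>n. 0 < n \<Longrightarrow> continuous_map X (circle_top n) (\<lambda>x. g x n)"
  shows "continuous_map X solenoid_top g"
  unfolding solenoid_top_def continuous_map_in_subtopology continuous_map_componentwise
  using assms solenoid_PiE by (auto simp: PiE_iff)

lemma continuous_map_solenoid_proj: "0 < n \<Longrightarrow> continuous_map solenoid_top (circle_top n) (\<lambda>s. s n)"
  unfolding solenoid_top_def
  by (intro continuous_map_from_subtopology continuous_map_product_projection) simp

text \<open>Continuity is joint in time and point. In each coordinate, seen in the complex plane,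
  translation by \<open>t\<close> is multiplication by
  \<open>cis (2 * pi * t / real n)\<close>.\<close>

lemma continuous_map_translate:
  "continuous_map (prod_topology euclidean solenoid_top) solenoid_top (\<lambda>z. translate (snd z) (fst z))"
proof (rule continuous_map_into_solenoid)
  fix n :: nat assume n: "0 < n"
  let ?P = "prod_topology (euclidean :: real topology) solenoid_top"
  show "continuous_map ?P (circle_top n) (\<lambda>z. translate (snd z) (fst z) n)"
  proof (rule continuous_map_into_circle[OF n])
    show "(\<lambda>z. translate (snd z) (fst z) n) \<in> topspace ?P \<rightarrow> topspace (circle_top n)"
      using n solenoid_PiE[OF translate_in_solenoid]
      by (auto simp: topspace_solenoid_top topspace_circle_top carrier_circle_group PiE_iff)
    have "continuous_map ?P euclidean (\<lambda>z. circle_emb n (snd z n) * cis (2 * pi * fst z / real n))"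
    proof (rule continuous_map_mult)
      have "continuous_map ?P euclidean (circle_emb n \<circ> ((\<lambda>s. s n) \<circ> snd))"
        by (intro continuous_map_compose[OF _ continuous_map_circle_emb[OF n]]
            continuous_map_compose[OF continuous_map_snd continuous_map_solenoid_proj[OF n]])
      then show "continuous_map ?P euclidean (\<lambda>z. circle_emb n (snd z n))" by (simp add: o_def)
      have "continuous_map euclidean euclidean (\<lambda>t. cis (2 * pi * t / real n))"
        using n by (auto intro!: continuous_intros)
      from continuous_map_compose[OF continuous_map_fst this]
      show "continuous_map ?P euclidean (\<lambda>z. cis (2 * pi * fst z / real n))" by (simp add: o_def)
    qed
    then show "continuous_map ?P euclidean (\<lambda>z. circle_emb n (translate (snd z) (fst z) n))"
    proof (rule continuous_map_eq)
      fix z assume "z \<in> topspace ?P"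
      then have "snd z \<in> solenoid" by (auto simp: topspace_solenoid_top)
      then obtain x where x: "snd z n = cls n x" using n by (rule solenoid_coordinate)
      show "circle_emb n (snd z n) * cis (2 * pi * fst z / real n) =
          circle_emb n (translate (snd z) (fst z) n)"
        by (simp add: translate_apply[where x = x] n x circle_emb_cls cis_mult
            add_divide_distrib distrib_left)
    qed
  qed
qed (auto simp: topspace_solenoid_top translate_in_solenoid)

text \<open>The distance moved is jointly continuous and vanishes at time 0. Compactness enters
  through the tube lemma, which gives one \<delta> for all points.\<close>

lemma translate_uniformly_small:
  assumes d: "compatible_metric d" and "0 < e"
  obtains \<delta> where "0 < \<delta>" "\<And>s t. s \<in> solenoid \<Longrightarrow> \<bar>t\<bar> < \<delta> \<Longrightarrow> d (translate s t) s < e"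
proof -
  interpret Metric_space solenoid d using d by (simp add: compatible_metric_def)
  have top: "mtopology = solenoid_top" using d by (simp add: compatible_metric_def)
  let ?P = "prod_topology (euclidean :: real topology) solenoid_top"
  let ?W = "{z \<in> topspace ?P. d (translate (snd z) (fst z)) (snd z) \<in> {..<e}}"
  have "continuous_map ?P euclidean (\<lambda>z. d (translate (snd z) (fst z)) (snd z))"
    using continuous_map_mdist[of ?P Self "\<lambda>z. translate (snd z) (fst z)" snd]
    by (simp add: top continuous_map_translate continuous_map_snd mtopology_of_def)
  then have W: "openin ?P ?W" by (rule openin_continuous_map_preimage) simp
  have "compactin solenoid_top solenoid"
    using compact_solenoid_top by (simp add: compact_space_def topspace_solenoid_top)
  moreover have "{0} \<times> solenoid \<subseteq> ?W"
    using \<open>0 < e\<close> by (auto simp: topspace_solenoid_top translate_0)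
  ultimately have "\<exists>U V. openin euclidean U \<and> openin solenoid_top V \<and> 0 \<in> U \<and> solenoid \<subseteq> V \<and> U \<times> V \<subseteq> ?W"
    by (intro tube_lemma_right[OF W]) simp_all
  then obtain U V where U: "open U" "0 \<in> U" and V: "solenoid \<subseteq> V" and UV: "U \<times> V \<subseteq> ?W"
    unfolding open_openin[symmetric] by blast
  obtain \<delta> where \<delta>: "0 < \<delta>" "ball 0 \<delta> \<subseteq> U" using U by (metis openE)
  show thesis
  proof (rule that[OF \<delta>(1)])
    fix s t assume "s \<in> solenoid" "\<bar>t\<bar> < \<delta>"
    then have "(t, s) \<in> U \<times> V" using \<delta>(2) V by auto
    then show "d (translate s t) s < e" using UV by auto
  qed
qed

section \<open>From degree-one maps of the line to leafwise maps of the solenoid\<close>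

section \<open>Maps of the solenoid induced by maps of the line\<close>

text \<open>A map induced by \<open>G\<close> moves each point along its leaf, by the displacement of \<open>G\<close> at any
  lift of the projection to \<open>\<real>/\<int>\<close>.\<close>

definition solenoid_map :: "(real \<Rightarrow> real) \<Rightarrow> (nat \<Rightarrow> real set) \<Rightarrow> nat \<Rightarrow> real set"
  where "solenoid_map G s = (let x = (SOME x. s 1 = cls 1 x) in translate s (G x - x))"

text \<open>Two lifts of \<open>s 1\<close> differ by an integer, and the displacement of a
  degree-one map has period 1; the choice of lift is immaterial.\<close>

lemma solenoid_map_eq:
  assumes "degree_one G" "s 1 = cls 1 x"
  shows "solenoid_map G s = translate s (G x - x)"
proof -
  define y where "y = (SOME x. s 1 = cls 1 x)"
  have "s 1 = cls 1 y" unfolding y_def using assms(2) by (rule someI)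
  then obtain k :: int where "y = x + of_int k" using assms(2) cls_eq_iff[of 1 x y] by auto
  then show ?thesis
    unfolding solenoid_map_def Let_def y_def[symmetric] by (simp add: degree_one_of_int[OF assms(1)])
qed

lemma solenoid_map_apply:
  assumes "degree_one G" "s \<in> solenoid" "0 < n" "s n = cls n x"
  shows "solenoid_map G s n = cls n (G x)"
proof -
  have "s 1 = cls 1 x" using assms(2-4) by (rule solenoid_proj_1)
  with assms(1) have "solenoid_map G s = translate s (G x - x)" by (rule solenoid_map_eq)
  then show ?thesis using translate_apply[of n s x] assms(3,4) by simp
qed

lemma solenoid_map_in_solenoid: "s \<in> solenoid \<Longrightarrow> solenoid_map G s \<in> solenoid"
  by (simp add: solenoid_map_def Let_def translate_in_solenoid)

text \<open>Displacements along a leaf add up: \<open>(H x - x) + (G (H x) - H x)\<close> is the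
  displacement of \<open>G \<circ> H\<close> at \<open>x\<close>.\<close>

lemma solenoid_map_compose:
  assumes "degree_one G" "degree_one H" "s \<in> solenoid"
  shows "solenoid_map G (solenoid_map H s) = solenoid_map (G \<circ> H) s"
proof -
  obtain x where x: "s 1 = cls 1 x" using solenoid_coordinate[OF assms(3)] by (metis zero_less_one)
  have "degree_one (G \<circ> H)" using assms(1,2) by (simp add: degree_one_def)
  moreover have "solenoid_map H s 1 = cls 1 (H x)"
    using assms x by (intro solenoid_map_apply) simp_all
  ultimately show ?thesis
    using assms x
    by (simp add: solenoid_map_eq[where x = x] solenoid_map_eq[where x = "H x"] translate_translate)
qed

lemma solenoid_map_funpow:
  assumes "degree_one G" "s \<in> solenoid"
  shows "(solenoid_map G ^^ n) s = solenoid_map (G ^^ n) s"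
proof (induction n)
  case 0
  then show ?case by (simp add: solenoid_map_def translate_0 assms(2))
next
  case (Suc n)
  then show ?case by (simp add: solenoid_map_compose degree_one_funpow assms o_def)
qed

text \<open>Coordinate \<open>n\<close> of the image depends only on coordinate \<open>n\<close> of
  the point, through the circle map \<open>g\<close> induced by \<open>G\<close>; continuity of
  \<open>g\<close> comes from the quotient topology.\<close>

lemma continuous_map_solenoid_map:
  assumes "degree_one G" "continuous_on UNIV G"
  shows "continuous_map solenoid_top solenoid_top (solenoid_map G)"
proof (rule continuous_map_into_solenoid)
  fix n :: nat assume n: "0 < n"
  define g where "g A = cls n (G (SOME x. A = cls n x))" for A
  have g: "g (cls n x) = cls n (G x)" for x
  proof -
    have "cls n x = cls n (SOME y. cls n x = cls n y)" by (rule someI) (rule refl)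
    then obtain k :: int where "(SOME y. cls n x = cls n y) = x + of_int (int n * k)"
      using cls_eq_iff[of n x] by auto
    then have "g (cls n x) = cls n (G x + of_int (int n * k))"
      by (simp only: g_def degree_one_of_int[OF assms(1)])
    then show ?thesis using cls_eq_iff[of n "G x"] by auto
  qed
  have "continuous_map euclidean euclidean G" using assms(2) by simp
  then have "continuous_map euclidean (circle_top n) (cls n \<circ> G)"
    by (rule continuous_map_compose) (rule quotient_imp_continuous_map[OF quotient_map_cls])
  then have "continuous_map euclidean (circle_top n) (g \<circ> cls n)"
    by (simp add: o_def g)
  then have "continuous_map (circle_top n) (circle_top n) g"
    using continuous_compose_quotient_map_eq[OF quotient_map_cls] by blast
  with continuous_map_solenoid_proj[OF n]
  have "continuous_map solenoid_top (circle_top n) (g \<circ> (\<lambda>s. s n))"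
    by (rule continuous_map_compose)
  then show "continuous_map solenoid_top (circle_top n) (\<lambda>s. solenoid_map G s n)"
  proof (rule continuous_map_eq)
    fix s assume "s \<in> topspace solenoid_top"
    then have s: "s \<in> solenoid" by (simp add: topspace_solenoid_top)
    then obtain x where "s n = cls n x" using n by (rule solenoid_coordinate)
    then show "(g \<circ> (\<lambda>s. s n)) s = solenoid_map G s n"
      using s n assms(1) by (simp add: g solenoid_map_apply)
  qed
qed (simp add: topspace_solenoid_top solenoid_map_in_solenoid)

text \<open>A preimage is found on the leaf of \<open>s\<close> itself, by sliding from the lift
  \<open>x\<close> to a point \<open>y\<close> with \<open>G y = x\<close>.\<close>

lemma solenoid_map_surj:
  assumes "degree_one G" "surj G"
  shows "solenoid_map G ` solenoid = solenoid"
proof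
  show "solenoid_map G ` solenoid \<subseteq> solenoid" by (auto simp: solenoid_map_in_solenoid)
  show "solenoid \<subseteq> solenoid_map G ` solenoid"
  proof
    fix s assume s: "s \<in> solenoid"
    obtain x where x: "s 1 = cls 1 x" using solenoid_coordinate[OF s] by (metis zero_less_one)
    obtain y where y: "x = G y" using assms(2) by (rule surjE)
    have "translate s (y - x) 1 = cls 1 y" using translate_apply[of 1 s x] x by simp
    then have "solenoid_map G (translate s (y - x)) = translate (translate s (y - x)) (G y - y)"
      by (rule solenoid_map_eq[OF assms(1)])
    then have "solenoid_map G (translate s (y - x)) = s"
      using s y by (simp add: translate_translate translate_0)
    then show "s \<in> solenoid_map G ` solenoid" using s translate_in_solenoid by (metis imageI)
  qed
qed

lemma induced_via_eq:
  assumes "degree_one F" "induced_via F f" "s \<in> solenoid"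
  shows "f s = solenoid_map F s"
proof
  obtain fn where fn: "\<And>n x. 0 < n \<Longrightarrow> fn n (cls n x) = cls n (F x)"
    and f: "f s = (\<lambda>n\<in>{0<..}. fn n (s n))"
    using assms(2,3) unfolding induced_via_def by blast
  fix n
  show "f s n = solenoid_map F s n"
  proof (cases "0 < n")
    case True
    then obtain x where "s n = cls n x" using solenoid_coordinate[OF assms(3)] by blast
    then show ?thesis using True assms by (simp add: f fn solenoid_map_apply)
  next
    \<comment> \<open>At index 0 both families take the default value of extensional
      functions.\<close>
    case False
    moreover have "solenoid_map F s \<in> extensional {0<..}"
      using solenoid_PiE[OF solenoid_map_in_solenoid[OF assms(3)]] by (simp add: PiE_def)
    ultimately show ?thesis by (auto simp: f extensional_def)
  qed
qed

text \<open>Needed because \<open>induced_via\<close> determines \<open>f\<close> only on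
  \<open>solenoid\<close>; invariance keeps the orbit where the two maps agree.\<close>

lemma funpow_eq_on:
  assumes "\<And>x. x \<in> S \<Longrightarrow> f x = g x" "\<And>x. x \<in> S \<Longrightarrow> g x \<in> S" "x \<in> S"
  shows "(f ^^ n) x = (g ^^ n) x"
proof -
  have "(f ^^ n) x = (g ^^ n) x \<and> (g ^^ n) x \<in> S"
    using assms by (induction n) simp_all
  then show ?thesis ..
qed

lemma induced_funpow:
  assumes "degree_one F" "induced_via F f" "s \<in> solenoid" "s 1 = cls 1 x"
  shows "(f ^^ n) s = translate s ((F ^^ n) x - x)"
proof -
  have "(f ^^ n) s = (solenoid_map F ^^ n) s"
    by (rule funpow_eq_on[OF induced_via_eq[OF assms(1,2)] solenoid_map_in_solenoid assms(3)])
  also have "\<dots> = solenoid_map (F ^^ n) s" by (rule solenoid_map_funpow[OF assms(1,3)])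
  also have "\<dots> = translate s ((F ^^ n) x - x)"
    by (rule solenoid_map_eq[OF degree_one_funpow[where n = n]]) (fact assms)+
  finally show ?thesis .
qed

text \<open>At each time both orbits lie on one leaf, apart by
  \<open>(F ^^ n) x - (F ^^ n) y\<close>; uniform smallness of short translations turns this into a
  bound on \<open>d\<close>.\<close>

lemma asymptotic_orbits_translate:
  assumes "degree_one F" "induced_via F f" "compatible_metric d" "s \<in> solenoid" "s 1 = cls 1 x"
    and lim: "(\<lambda>n. (F ^^ n) x - (F ^^ n) y) \<longlonglongrightarrow> 0"
  shows "asymptotic_orbits d f s (translate s (y - x))"
  unfolding asymptotic_orbits_def
proof (rule tendstoI)
  interpret Metric_space solenoid d using assms(3) by (simp add: compatible_metric_def)
  let ?s = "translate s (y - x)"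
  have y: "?s 1 = cls 1 y" using translate_apply[of 1 s x] assms(5) by simp
  have s': "?s \<in> solenoid" using assms(4) by (rule translate_in_solenoid)
  note iter = induced_funpow[OF assms(1,2)]
  have eq: "(f ^^ n) s = translate ((f ^^ n) ?s) ((F ^^ n) x - (F ^^ n) y)" for n
    using assms(4) by (simp add: iter[OF assms(4,5)] iter[OF s' y] translate_translate)
  have in_S: "(f ^^ n) ?s \<in> solenoid" for n
    using iter[OF s' y] translate_in_solenoid[OF s'] by simp
  fix e :: real assume "0 < e"
  then obtain \<delta> where \<delta>: "0 < \<delta>" "\<And>s t. s \<in> solenoid \<Longrightarrow> \<bar>t\<bar> < \<delta> \<Longrightarrow> d (translate s t) s < e"
    using translate_uniformly_small[OF assms(3)] by blast
  have "\<forall>\<^sub>F n in sequentially. \<bar>(F ^^ n) x - (F ^^ n) y\<bar> < \<delta>"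
    using tendstoD[OF lim \<delta>(1)] by (simp add: dist_real_def)
  then show "\<forall>\<^sub>F n in sequentially. dist (d ((f ^^ n) s) ((f ^^ n) ?s)) 0 < e"
    by eventually_elim (use \<delta>(2)[OF in_S] in \<open>simp add: eq\<close>)
qed

section \<open>Monotonicity and degree of an arbitrary lift\<close>

section \<open>Lifts of circle homeomorphisms\<close>

text \<open>Distinct integers are at least 1 apart, and the line is connected.\<close>

lemma continuous_Ints_valued_constant:
  fixes g :: "real \<Rightarrow> real"
  assumes "continuous_on UNIV g" and "\<And>x. g x \<in> \<int>"
  obtains c where "\<And>x. g x = c"
proof -
  have "g constant_on UNIV"
  proof (rule continuous_discrete_range_constant[OF connected_UNIV assms(1)])
    fix x
    have "1 \<le> norm (g y - g x)" if "g y \<noteq> g x" for y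
      using that assms(2) Ints_nonzero_abs_ge1[of "g y - g x"] by simp
    then show "\<exists>e>0. \<forall>y. y \<in> UNIV \<and> g y \<noteq> g x \<longrightarrow> e \<le> norm (g y - g x)"
      by (intro exI[of _ 1]) simp
  qed
  then show thesis using that by (auto simp: constant_on_def)
qed

lemma cls_1_eq_iff: "cls 1 x = cls 1 y \<longleftrightarrow> y - x \<in> \<int>"
proof -
  have "cls 1 x = cls 1 y \<longleftrightarrow> (\<exists>k::int. y - x = of_int k)"
    unfolding cls_eq_iff by (simp add: algebra_simps)
  then show ?thesis by (auto simp: Ints_def)
qed

text \<open>\<open>homeo_plus_circle\<close> provides only some increasing lift, but two lifts
  differ by a continuous integer-valued function, hence by a constant.\<close>

lemma is_lift_strict_mono:
  assumes "homeo_plus_circle f1" "is_lift F f1"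
  shows "strict_mono F"
proof -
  obtain G where G: "is_lift G f1" "strict_mono G" using assms(1) by (auto simp: homeo_plus_circle_def)
  have "continuous_on UNIV (\<lambda>x. F x - G x)"
    using assms(2) G(1) by (intro continuous_on_diff) (simp_all add: is_lift_def)
  moreover have "F x - G x \<in> \<int>" for x
    using assms(2) G(1) cls_1_eq_iff[of "G x" "F x"] unfolding is_lift_def by metis
  ultimately obtain c where "\<And>x. F x - G x = c"
    using continuous_Ints_valued_constant[of "\<lambda>x. F x - G x"] by blast
  then have "F = (\<lambda>x. G x + c)" by (auto simp: algebra_simps)
  then show ?thesis using G(2) by (simp add: strict_mono_def)
qed

text \<open>The degree is a positive integer; were it at least 2, \<open>F\<close> would take the value \<open>F 0 + 1\<close>
  strictly between 0 and 1, against the injectivity of \<open>f1\<close>.\<close>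

lemma is_lift_degree_one:
  assumes "homeo_plus_circle f1" "is_lift F f1"
  shows "degree_one F"
proof -
  have cont: "continuous_on UNIV F" and lift: "\<And>x. f1 (cls 1 x) = cls 1 (F x)"
    using assms(2) by (simp_all add: is_lift_def)
  have mono: "strict_mono F" by (rule is_lift_strict_mono[OF assms])
  have "continuous_on UNIV (\<lambda>x. F (x + 1) - F x)"
    by (intro continuous_on_diff cont continuous_on_compose2[OF cont] continuous_intros) simp
  moreover have Ints: "F (x + 1) - F x \<in> \<int>" for x
  proof -
    have "cls 1 x = cls 1 (x + 1)" unfolding cls_1_eq_iff by simp
    then show ?thesis by (metis lift cls_1_eq_iff)
  qed
  ultimately obtain c where c: "\<And>x. F (x + 1) - F x = c"
    using continuous_Ints_valued_constant[of "\<lambda>x. F (x + 1) - F x"] by blast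
  have "c \<in> \<int>" using Ints[of 0] by (simp only: c)
  have F1: "F 1 = F 0 + c" using c[of 0] by simp
  moreover have "F 0 < F 1" using mono by (simp add: strict_mono_def)
  ultimately have c1: "1 \<le> c" using \<open>c \<in> \<int>\<close> Ints_nonzero_abs_ge1[of c] by auto
  then have "\<exists>y\<ge>0. y \<le> 1 \<and> F y = F 0 + 1"
    using F1 by (intro IVT' continuous_on_subset[OF cont]) simp_all
  then obtain y where y: "0 \<le> y" "y \<le> 1" "F y = F 0 + 1" by blast
  have "f1 (cls 1 0) = f1 (cls 1 y)" using y(3) by (simp only: lift cls_1_eq_iff) simp
  moreover have "inj_on f1 (topspace (circle_top 1))"
    using assms(1) unfolding homeo_plus_circle_def by (blast dest: homeomorphic_imp_injective_map)
  ultimately have "cls 1 0 = cls 1 y"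
    by (simp add: inj_on_def topspace_circle_top carrier_circle_group)
  then have "y \<in> \<int>" by (simp only: cls_1_eq_iff) simp
  then have "y = 0 \<or> y = 1" using y(1,2) Ints_nonzero_abs_ge1[of y] by auto
  then have "c = 1" using y(3) F1 by auto
  then show ?thesis unfolding degree_one_def using c by (metis add.commute diff_add_cancel)
qed

section \<open>Asymptotics in the rational case, and both cases on the solenoid\<close>

section \<open>Rational and irrational rotation numbers\<close>

lemma continuous_on_funpow:
  fixes F :: "'a::topological_space \<Rightarrow> 'a"
  assumes "continuous_on UNIV F"
  shows "continuous_on UNIV (F ^^ n)"
proof (induction n)
  case (Suc n)
  then have "continuous_on UNIV (F \<circ> F ^^ n)"
    by (rule continuous_on_compose) (rule continuous_on_subset[OF assms subset_UNIV])
  then show ?case by simp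
qed (simp add: id_def)

text \<open>Convergence to a fixed point of \<open>G\<close> controls only the times divisible by
  \<open>q\<close>. The remaining times need fewer than \<open>q\<close> further iterates of
  \<open>F\<close>, all of them continuous.\<close>

lemma rational_orbit_asymptotic:
  assumes "mono F" "degree_one F" "continuous_on UNIV F" "0 < q"
    and rot: "rotation_number F = real p / real q"
  obtains y where "(F ^^ q) y = y + real p" "(\<lambda>n. (F ^^ n) x - (F ^^ n) y) \<longlonglongrightarrow> 0"
proof -
  define G where "G u = (F ^^ q) u - real p" for u
  have iter: "(G ^^ n) u = (F ^^ (q * n)) u - real (n * p)" for n u
  proof (induction n)
    case (Suc n)
    have "(F ^^ q) ((F ^^ (q * n)) u + of_int (- int (n * p)))
        = (F ^^ q) ((F ^^ (q * n)) u) + of_int (- int (n * p))"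
      by (rule degree_one_of_int[OF degree_one_funpow[OF assms(2)]])
    then show ?case using Suc by (simp add: G_def funpow_add)
  qed simp
  have "mono G" using mono_pow[OF assms(1), of q] by (simp add: G_def mono_def)
  moreover have "continuous_on UNIV G"
    unfolding G_def by (intro continuous_intros continuous_on_funpow assms(3))
  \<comment> \<open>Over \<open>q * n\<close> steps the drift is exactly \<open>n * p\<close>, which
    is what \<open>n\<close> applications of \<open>G\<close> subtract.\<close>
  moreover have "\<bar>(G ^^ n) x\<bar> \<le> \<bar>x\<bar> + 2" for n
    using rotation_number_displacement[OF assms(1,2), of "q * n" x] \<open>0 < q\<close> by (simp add: rot iter)
  ultimately obtain y where y: "G y = y" and lim: "(\<lambda>n. (G ^^ n) x) \<longlonglongrightarrow> y"
    by (rule mono_bounded_orbit_tendsto_fixpoint)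
  have Gy: "(G ^^ n) y = y" for n by (induction n) (simp_all add: y)
  \<comment> \<open>Summing over all residues gives one continuous function, zero at
    \<open>y\<close>, that serves whatever \<open>n mod q\<close> is.\<close>
  define \<psi> where "\<psi> u = (\<Sum>r<q. \<bar>(F ^^ r) u - (F ^^ r) y\<bar>)" for u
  have "isCont \<psi> y"
    unfolding \<psi>_def using continuous_on_funpow[OF assms(3)]
    by (intro continuous_intros) (simp add: continuous_on_eq_continuous_at)
  moreover have "filterlim (\<lambda>n. n div q) sequentially sequentially"
    using \<open>0 < q\<close> by (rule filterlim_at_top_div_const_nat)
  then have "(\<lambda>n. (G ^^ (n div q)) x) \<longlonglongrightarrow> y" by (rule filterlim_compose[OF lim])
  ultimately have "(\<lambda>n. \<psi> ((G ^^ (n div q)) x)) \<longlonglongrightarrow> \<psi> y" by (rule isCont_tendsto_compose)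
  moreover have "\<psi> y = 0" by (simp add: \<psi>_def)
  ultimately have \<psi>: "(\<lambda>n. \<psi> ((G ^^ (n div q)) x)) \<longlonglongrightarrow> 0" by simp
  \<comment> \<open>The integer shift is the same for \<open>x\<close> and \<open>y\<close>, so it
    cancels in their difference.\<close>
  have decomp: "(F ^^ n) u = (F ^^ (n mod q)) ((G ^^ (n div q)) u) + real (n div q * p)" for n u
  proof -
    have "(F ^^ n) u = (F ^^ (n mod q)) ((F ^^ (q * (n div q))) u)"
      by (metis funpow_add mod_mult_div_eq o_apply)
    also have "\<dots> = (F ^^ (n mod q)) ((G ^^ (n div q)) u + of_int (int (n div q * p)))"
      by (simp add: iter)
    also have "\<dots> = (F ^^ (n mod q)) ((G ^^ (n div q)) u) + of_int (int (n div q * p))"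
      by (rule degree_one_of_int[OF degree_one_funpow[OF assms(2)]])
    finally show ?thesis by simp
  qed
  have "norm ((F ^^ n) x - (F ^^ n) y) \<le> \<psi> ((G ^^ (n div q)) x)" for n
  proof -
    have "(F ^^ n) x - (F ^^ n) y = (F ^^ (n mod q)) ((G ^^ (n div q)) x) - (F ^^ (n mod q)) y"
      by (simp add: decomp[of n] Gy)
    moreover have "\<bar>(F ^^ (n mod q)) u - (F ^^ (n mod q)) y\<bar> \<le> \<psi> u" for u
      unfolding \<psi>_def using \<open>0 < q\<close> by (intro member_le_sum) simp_all
    ultimately show ?thesis by simp
  qed
  then have "(\<lambda>n. (F ^^ n) x - (F ^^ n) y) \<longlonglongrightarrow> 0"
    by (intro Lim_null_comparison[OF _ \<psi>]) simp
  moreover have "(F ^^ q) y = y + real p" using y by (simp add: G_def algebra_simps)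
  ultimately show thesis using that by blast
qed

theorem theorem4p11:
  fixes f :: "(nat \<Rightarrow> real set) \<Rightarrow> (nat \<Rightarrow> real set)"
    and f1 :: "real set \<Rightarrow> real set"
    and F :: "real \<Rightarrow> real"
  assumes "homeo_plus_solenoid f"
    and "homeo_plus_circle f1"
    and "is_lift F f1"
    and "induced_via F f"
  shows "(\<forall>p q :: nat. 0 < p \<longrightarrow> 0 < q \<longrightarrow> rotation_number F = real p / real q \<longrightarrow>
            (\<forall>d. compatible_metric d \<longrightarrow>
              (\<forall>s\<in>solenoid. fiber_periodic p q f s \<or>
                 (\<exists>s'. fiber_periodic p q f s' \<and> asymptotic_orbits d f s s')))) \<and>
         (rotation_number F \<notin> \<rat> \<longrightarrow>
            (\<exists>h. continuous_map solenoid_top solenoid_top h \<and> h ` solenoid = solenoid \<and>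
                 (\<forall>s\<in>solenoid. h (f s) = translate (h s) (rotation_number F))))"
proof (intro conjI allI impI ballI)
  have cont: "continuous_on UNIV F" using assms(3) by (simp add: is_lift_def)
  have mono: "mono F" by (rule strict_mono_mono[OF is_lift_strict_mono[OF assms(2,3)]])
  have deg: "degree_one F" by (rule is_lift_degree_one[OF assms(2,3)])
  {
    fix p q d s
    assume pq: "0 < p" "0 < q" and rot: "rotation_number F = real p / real q"
      and d: "compatible_metric d" and s: "s \<in> solenoid"
    obtain x where x: "s 1 = cls 1 x" using zero_less_one by (rule solenoid_coordinate[OF s])
    obtain y where y: "(F ^^ q) y = y + real p" "(\<lambda>n. (F ^^ n) x - (F ^^ n) y) \<longlonglongrightarrow> 0"
      using rational_orbit_asymptotic[OF mono deg cont pq(2) rot] by blast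
    \<comment> \<open>The fiber periodic point sits on the leaf of \<open>s\<close>, where the first
      coordinate lifts to \<open>y\<close>.\<close>
    let ?s = "translate s (y - x)"
    have s': "?s \<in> solenoid" using s by (rule translate_in_solenoid)
    have "?s 1 = cls 1 y" using translate_apply[of 1 s x] x by simp
    then have "(f ^^ q) ?s = translate ?s ((F ^^ q) y - y)"
      by (rule induced_funpow[OF deg assms(4) s'])
    then have "fiber_periodic p q f ?s" using pq s' by (simp add: fiber_periodic_def y(1))
    moreover have "asymptotic_orbits d f s ?s"
      by (rule asymptotic_orbits_translate[OF deg assms(4) d s x y(2)])
    ultimately show "fiber_periodic p q f s \<or>
        (\<exists>s'. fiber_periodic p q f s' \<and> asymptotic_orbits d f s s')" by blast
  next
    assume irrational: "rotation_number F \<notin> \<rat>"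
    obtain h where h: "mono h" "degree_one h" and semi: "\<And>x. h (F x) = h x + rotation_number F"
      using mono_semiconjugacy_exists[OF mono deg] by blast
    have h_cont: "continuous_on UNIV h"
      by (rule irrational_semiconjugacy_continuous[OF h(2,1) semi irrational])
    \<comment> \<open>The semiconjugacy is \<open>solenoid_map h\<close>: both sides move
      \<open>s\<close> by \<open>h x + rotation_number F - x\<close> along its leaf.\<close>
    have "solenoid_map h (f s) = translate (solenoid_map h s) (rotation_number F)"
      if s: "s \<in> solenoid" for s
    proof -
      obtain x where x: "s 1 = cls 1 x" using zero_less_one by (rule solenoid_coordinate[OF s])
      have fs: "f s = translate s (F x - x)" using induced_funpow[OF deg assms(4) s x, of 1] by simp
      then have "f s 1 = cls 1 (F x)" using translate_apply[of 1 s x] x by simp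
      then have "solenoid_map h (f s) = translate (f s) (h (F x) - F x)"
        by (rule solenoid_map_eq[OF h(2)])
      moreover have "solenoid_map h s = translate s (h x - x)" using h(2) x by (rule solenoid_map_eq)
      ultimately show ?thesis using s by (simp add: fs translate_translate semi algebra_simps)
    qed
    then show "\<exists>h. continuous_map solenoid_top solenoid_top h \<and> h ` solenoid = solenoid \<and>
        (\<forall>s\<in>solenoid. h (f s) = translate (h s) (rotation_number F))"
      using continuous_map_solenoid_map[OF h(2) h_cont]
        solenoid_map_surj[OF h(2) degree_one_surj[OF h(2) h_cont]] by blast
  }
qed

end
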